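(* Let $k$ be a positive integer and let $\alpha$ be a real number with $0<\alpha<1$. There exists an integer $d_0$ (which may depend on $k$ and $\alpha$) such that for every integer $d\geq d_0$, there exist two disjoint lattice $(d,k)$-polytopes $P$ and $Q$ such that $$d(P,Q)\leq\frac{1}{k^{d^\alpha}d^{(1-\alpha)d^\alpha}}.$$
   Context: A polytope in $\mathbb{R}^d$ is the convex hull of a non-empty finite set of points. A lattice polytope is a polytope all of whose vertices belong to $\mathbb{Z}^d$. A lattice $(d,k)$-polytope is a lattice polytope (of any dimension) contained in the hypercube $[0,k]^d$. $d(P,Q)$ denotes the minimal Euclidean distance between a point of $P$ and a point of $Q$ (the letter $d$ alone denotes the dimension of the ambient space). *)

theory Defs
  imports "HOL-Analysis.Analysis" "HOL-Analysis.Finite_Function_Topology"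
begin

text \<open>
  The dimension \<open>d\<close> is quantified inside the statement, so \<open>\<real>\<^sup>d\<close> cannot be
  a type depending on \<open>d\<close>. It is represented as the linear subspace \<open>Rspace d\<close> of the real vector
  space of finitely supported sequences, with coordinates \<open>0, \<dots>, d - 1\<close>. Convex hulls, polytopes
  and extreme points are the library notions for that vector space.

  The metric that the library puts on finitely supported functions is the \<open>\<ell>\<^sub>1\<close> one,
  so \<open>dist\<close> and \<open>setdist\<close> must not be used here; \<open>edist\<close> and \<open>esetdist\<close> are the Euclidean versions.
\<close>

type_synonym rseq = "nat \<Rightarrow>\<^sub>0 real"

definition Rspace :: "nat \<Rightarrow> rseq set" where
  "Rspace d = {x. Poly_Mapping.keys x \<subseteq> {..<d}}"

definition Zlattice :: "nat \<Rightarrow> rseq set" where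
  "Zlattice d = {x \<in> Rspace d. \<forall>i<d. Poly_Mapping.lookup x i \<in> \<int>}"

definition hypercube :: "nat \<Rightarrow> nat \<Rightarrow> rseq set" where
  "hypercube d k =
     {x \<in> Rspace d. \<forall>i<d. 0 \<le> Poly_Mapping.lookup x i \<and> Poly_Mapping.lookup x i \<le> real k}"

text \<open>The library's \<^const>\<open>polytope\<close> admits the empty set, which is excluded here.\<close>

definition lattice_polytope :: "nat \<Rightarrow> rseq set \<Rightarrow> bool" where
  "lattice_polytope d P \<longleftrightarrow>
     polytope P \<and> P \<noteq> {} \<and> P \<subseteq> Rspace d \<and> {v. v extreme_point_of P} \<subseteq> Zlattice d"

definition lattice_dk_polytope :: "nat \<Rightarrow> nat \<Rightarrow> rseq set \<Rightarrow> bool" where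
  "lattice_dk_polytope d k P \<longleftrightarrow> lattice_polytope d P \<and> P \<subseteq> hypercube d k"

definition edist :: "nat \<Rightarrow> rseq \<Rightarrow> rseq \<Rightarrow> real" where
  "edist d x y = L2_set (\<lambda>i. Poly_Mapping.lookup x i - Poly_Mapping.lookup y i) {..<d}"

text \<open>For nonempty polytopes the infimum is a minimum, by compactness.\<close>

definition esetdist :: "nat \<Rightarrow> rseq set \<Rightarrow> rseq set \<Rightarrow> real" where
  "esetdist d P Q = Inf {edist d x y | x y. x \<in> P \<and> y \<in> Q}"

end

theory Submission
  imports Defs "HOL-Real_Asymp.Real_Asymp"
begin

text \<open>
  Split \<open>(n + 1) s \<le> d\<close> coordinates into consecutive blocks \<open>B\<^sub>0, \<dots>, B\<^sub>n\<close> of size \<open>s\<close> with indicator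
  vectors \<open>u\<^sub>i\<close>, put \<open>m = k s\<close>, and let \<open>f\<close> be the linear form with coefficient \<open>(-m)\<^sup>i\<close> on \<open>B\<^sub>i\<close>. It
  vanishes on the lattice points \<open>k u\<^sub>i + e\<^sub>j\<close> with \<open>j \<in> B\<^bsub>i+1\<^esub>\<close>. Let \<open>Q\<close> be the convex hull of the
  origin and these points for even \<open>i\<close>, and let \<open>P\<close> be the convex hull of the points \<open>e\<^sub>a\<close>, \<open>a \<in> B\<^sub>0\<close>,
  and of the sums of such an \<open>e\<^sub>a\<close> with the points for odd \<open>i\<close>. Then \<open>f\<close> is \<open>1\<close> on \<open>P\<close> and \<open>0\<close> on \<open>Q\<close>.
  Averaging over \<open>a\<close> and \<open>j\<close> replaces unit vectors by \<open>u\<^sub>0 / s\<close> and \<open>u\<^bsub>i+1\<^esub> / s\<close>; weighting the \<open>i\<close>-th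
  average by \<open>m\<^bsup>-(i+1)\<^esup>\<close> yields points of \<open>P\<close> and \<open>Q\<close> whose difference telescopes to
  \<open>\<plusminus>m\<^bsup>-n\<^esup> u\<^sub>n / s\<close>, of length at most \<open>m\<^bsup>-n\<^esup>\<close>. With \<open>n\<close> about \<open>2 d\<^sup>\<alpha>\<close> and \<open>s\<close> about
  \<open>d / n\<close>, the exponent is twice the required one, which absorbs all constants.
\<close>

section \<open>Coordinates, indicator vectors and linear forms\<close>

lemma lookup_scaleR [simp]:
  fixes x :: "'a \<Rightarrow>\<^sub>0 'b::real_vector"
  shows "Poly_Mapping.lookup (r *\<^sub>R x) i = r *\<^sub>R Poly_Mapping.lookup x i"
proof -
  have "finite {i. r *\<^sub>R Poly_Mapping.lookup x i \<noteq> 0}"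
    by (rule finite_subset[OF _ finite_lookup[of x]]) auto
  then show ?thesis
    by (simp add: scaleR_poly_mapping_def)
qed

abbreviation unit_vec :: "nat \<Rightarrow> rseq" where
  "unit_vec j \<equiv> Poly_Mapping.single j 1"

definition ind_vec :: "nat set \<Rightarrow> rseq" where
  "ind_vec A = (\<Sum>j\<in>A. unit_vec j)"

lemma lookup_ind_vec:
  "finite A \<Longrightarrow> Poly_Mapping.lookup (ind_vec A) i = of_bool (i \<in> A)"
  by (simp add: ind_vec_def lookup_sum lookup_single when_def)

definition weighted_sum :: "nat \<Rightarrow> (nat \<Rightarrow> real) \<Rightarrow> rseq \<Rightarrow> real" where
  "weighted_sum d c x = (\<Sum>j<d. c j * Poly_Mapping.lookup x j)"

lemma linear_weighted_sum: "linear (weighted_sum d c)"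
  by (rule linearI)
    (simp_all add: weighted_sum_def lookup_add sum.distrib sum_distrib_left algebra_simps)

lemma weighted_sum_unit_vec: "j < d \<Longrightarrow> weighted_sum d c (unit_vec j) = c j"
  by (simp add: weighted_sum_def lookup_single when_def if_distrib cong: if_cong)

section \<open>Convex hulls and convex combinations\<close>

lemma linear_const_on_convex_hull:
  fixes f :: "'a::real_vector \<Rightarrow> 'b::real_vector"
  assumes "linear f" "\<And>v. v \<in> V \<Longrightarrow> f v = b" "x \<in> convex hull V"
  shows "f x = b"
proof -
  have "convex hull V \<subseteq> f -` {b}"
    using assms by (intro hull_minimal convex_linear_vimage) auto
  with assms show ?thesis by auto
qed

lemma convex_average:
  fixes S :: "'a::real_vector set"
  assumes "convex S" "finite A" "A \<noteq> {}" "\<And>j. j \<in> A \<Longrightarrow> v + w j \<in> S"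
  shows "v + (1 / real (card A)) *\<^sub>R (\<Sum>j\<in>A. w j) \<in> S"
proof -
  have card: "real (card A) \<noteq> 0"
    using assms by simp
  have "(\<Sum>j\<in>A. (1 / real (card A)) *\<^sub>R (v + w j)) \<in> S"
    using assms card by (intro convex_sum) auto
  also have "(\<Sum>j\<in>A. (1 / real (card A)) *\<^sub>R (v + w j)) = v + (1 / real (card A)) *\<^sub>R (\<Sum>j\<in>A. w j)"
    using card by (simp add: scaleR_right_distrib sum.distrib scaleR_sum_right sum_constant_scaleR)
  finally show ?thesis .
qed

text \<open>The weight \<open>1 - sum a I\<close> left over goes to \<open>z\<close> itself, which
  makes the sum a convex combination of \<open>z\<close> and the points
  \<open>z + t i\<close>.\<close>

lemma convex_add_subunit_sum:
  fixes S :: "'a::real_vector set"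
  assumes "convex S" "finite I" "z \<in> S" "\<And>i. i \<in> I \<Longrightarrow> z + t i \<in> S"
    and "\<And>i. i \<in> I \<Longrightarrow> a i \<ge> 0" "sum a I \<le> 1"
  shows "z + (\<Sum>i\<in>I. a i *\<^sub>R t i) \<in> S"
proof -
  \<comment> \<open>\<open>None\<close> is a fresh index for \<open>z\<close>, with the leftover
    weight.\<close>
  let ?b = "\<lambda>j. case j of None \<Rightarrow> 1 - sum a I | Some i \<Rightarrow> a i"
  let ?y = "\<lambda>j. case j of None \<Rightarrow> z | Some i \<Rightarrow> z + t i"
  have "(\<Sum>j\<in>insert None (Some ` I). ?b j *\<^sub>R ?y j) \<in> S"
    using assms by (intro convex_sum) (auto simp: sum.reindex)
  also have "(\<Sum>j\<in>insert None (Some ` I). ?b j *\<^sub>R ?y j) =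
      (1 - sum a I) *\<^sub>R z + (\<Sum>i\<in>I. a i *\<^sub>R (z + t i))"
    using assms by (simp add: sum.reindex)
  also have "\<dots> = z + (\<Sum>i\<in>I. a i *\<^sub>R t i)"
    by (simp add: scaleR_right_distrib scaleR_left_diff_distrib sum.distrib scaleR_sum_left)
  finally show ?thesis .
qed

section \<open>Lattice polytopes in the hypercube\<close>

lemma convex_hypercube: "convex (hypercube d k)"
proof -
  have "hypercube d k = {x. (\<forall>i\<ge>d. Poly_Mapping.lookup x i = 0) \<and>
      (\<forall>i<d. 0 \<le> Poly_Mapping.lookup x i \<and> Poly_Mapping.lookup x i \<le> real k)}"
    unfolding hypercube_def Rspace_def by (auto simp: subset_iff in_keys_iff) (metis not_less)
  then show ?thesis
    by (auto simp: convex_def lookup_add intro!: convex_bound_le)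
qed

text \<open>Every extreme point of the hull belongs to \<open>V\<close>, and the hypercube is
  convex, so integrality and bounds need checking on \<open>V\<close> only.\<close>

lemma lattice_dk_polytope_convex_hull:
  assumes "finite V" "V \<noteq> {}"
    and "\<And>v i. v \<in> V \<Longrightarrow> i \<ge> d \<Longrightarrow> Poly_Mapping.lookup v i = 0"
    and "\<And>v i. v \<in> V \<Longrightarrow> Poly_Mapping.lookup v i \<in> \<nat>"
    and "\<And>v i. v \<in> V \<Longrightarrow> Poly_Mapping.lookup v i \<le> real k"
  shows "lattice_dk_polytope d k (convex hull V)"
proof -
  have R: "V \<subseteq> Rspace d"
    using assms(3) unfolding Rspace_def by (auto simp: in_keys_iff) (metis not_less)
  then have Z: "V \<subseteq> Zlattice d"
    using assms(4) Nats_subset_Ints by (auto simp: Zlattice_def)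
  have "V \<subseteq> hypercube d k"
    using R assms(4,5) Nats_altdef2[where 'a = real] by (auto simp: hypercube_def)
  then have "convex hull V \<subseteq> hypercube d k"
    by (rule hull_minimal) (rule convex_hypercube)
  moreover have "{v. v extreme_point_of convex hull V} \<subseteq> Zlattice d"
    using Z extreme_point_of_convex_hull by blast
  moreover have "convex hull V \<subseteq> Rspace d"
    using calculation(1) by (auto simp: hypercube_def)
  ultimately show ?thesis
    using assms(1,2) by (auto simp: lattice_dk_polytope_def lattice_polytope_def polytope_def)
qed

lemma esetdist_le_edist:
  assumes "x \<in> P" "y \<in> Q"
  shows "esetdist d P Q \<le> edist d x y"
  unfolding esetdist_def
proof (rule cInf_lower)
  show "bdd_below {edist d x y |x y. x \<in> P \<and> y \<in> Q}"
    by (rule bdd_belowI[of _ 0]) (auto simp: edist_def)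
qed (use assms in auto)

section \<open>Blocks of coordinates and their weights\<close>

definition block :: "nat \<Rightarrow> nat \<Rightarrow> nat set" where
  "block s i = {i * s..<(i + 1) * s}"

lemma finite_block [simp]: "finite (block s i)"
  and card_block [simp]: "card (block s i) = s"
  by (simp_all add: block_def)

text \<open>Blocks are the fibres of \<open>div s\<close>; their disjointness becomes a comparison
  of quotients.\<close>

lemma in_block_iff: "s > 0 \<Longrightarrow> j \<in> block s i \<longleftrightarrow> j div s = i"
  unfolding block_def
  by (auto simp: mult.commute[of i s] intro!: div_nat_eqI dividend_less_times_div)

lemma sum_inverse_powers_le_1:
  fixes m :: real
  assumes "m \<ge> 2"
  shows "(\<Sum>i<n. 1 / m ^ (i + 1)) \<le> 1"
proof -
  \<comment> \<open>The stronger bound carries the induction: for \<open>m \<ge> 2\<close> the slack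
    \<open>1 / m ^ n\<close> pays for the next term and the next slack.\<close>
  have "(\<Sum>i<n. 1 / m ^ (i + 1)) \<le> 1 - 1 / m ^ n"
  proof (induction n)
    case (Suc n)
    have "2 / m ^ Suc n \<le> 1 / m ^ n"
      using assms by (simp add: field_simps)
    with Suc show ?case by simp
  qed simp
  also have "\<dots> \<le> 1"
    using assms by simp
  finally show ?thesis .
qed

lemma close_lattice_polytopes:
  fixes k s n d :: nat
  assumes k: "k > 0" and m: "k * s \<ge> 2" and d: "(n + 1) * s \<le> d"
  shows "\<exists>P Q. lattice_dk_polytope d k P \<and> lattice_dk_polytope d k Q \<and> P \<inter> Q = {} \<and>
           esetdist d P Q \<le> 1 / real (k * s) ^ n"
proof -
  define m where "m = real (k * s)"
  have s: "s > 0" and m2: "m \<ge> 2"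
    using m by (auto simp: m_def intro!: Nat.gr0I simp del: of_nat_mult)
  define w where "w i j = real k *\<^sub>R ind_vec (block s i) + unit_vec j" for i j
  define VP where "VP = unit_vec ` block s 0 \<union>
    (\<lambda>(a, i, j). unit_vec a + w i j) `
      (block s 0 \<times> (SIGMA i:{i. i < n \<and> odd i}. block s (i + 1)))"
  define VQ where "VQ = insert 0
    ((\<lambda>(i, j). w i j) ` (SIGMA i:{i. i < n \<and> even i}. block s (i + 1)))"
  define P where "P = convex hull VP"
  define Q where "Q = convex hull VQ"
  have block_less: "j < d" if "j \<in> block s i" "i \<le> n" for i j
  proof -
    have "j < (i + 1) * s"
      using that by (simp add: block_def)
    also have "\<dots> \<le> (n + 1) * s"
      using that by (intro mult_right_mono) auto
    finally show ?thesis using d by simp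
  qed
  have zero_block: "0 \<in> block s 0"
    using s by (simp add: block_def)
  have lookup_w: "Poly_Mapping.lookup (w i j) l = real (k * of_bool (l div s = i) + of_bool (l = j))"
    for i j l
    using s by (auto simp: w_def lookup_add lookup_ind_vec lookup_single when_def in_block_iff)

  \<comment> \<open>Both hulls are lattice polytopes in the hypercube\<close>
  have VP: "lattice_dk_polytope d k P"
    unfolding P_def
  proof (rule lattice_dk_polytope_convex_hull)
    show "finite VP"
      by (auto simp: VP_def)
    show "VP \<noteq> {}"
      using zero_block by (auto simp: VP_def)
  next
    fix v l assume v: "v \<in> VP"
    then consider a where "a \<in> block s 0" "v = unit_vec a"
      | a i j where "a \<in> block s 0" "i < n" "odd i" "j \<in> block s (i + 1)" "v = unit_vec a + w i j"
      by (auto simp: VP_def)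
    then have "Poly_Mapping.lookup v l \<in> \<nat> \<and> Poly_Mapping.lookup v l \<le> real k \<and>
        (d \<le> l \<longrightarrow> Poly_Mapping.lookup v l = 0)"
    proof cases
      case 1
      then show ?thesis
        using k block_less[of a 0] by (auto simp: lookup_single when_def)
    next
      case 2
      have eq: "Poly_Mapping.lookup v l =
          real (of_bool (l = a) + k * of_bool (l div s = i) + of_bool (l = j))"
        using 2 by (auto simp: lookup_add lookup_w lookup_single when_def)
      have "a div s = 0" "j div s = i + 1"
        using 2 s in_block_iff by blast+
      \<comment> \<open>Oddness of \<open>i\<close> keeps blocks \<open>0\<close>, \<open>i\<close>
        and \<open>i + 1\<close> distinct, so the entries \<open>1\<close>, \<open>k\<close> and
        \<open>1\<close> never add up in one coordinate.\<close>
      moreover have "i \<noteq> 0"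
        using 2 by (auto intro!: Nat.gr0I)
      ultimately have "of_bool (l = a) + k * of_bool (l div s = i) + of_bool (l = j) \<le> k"
        using k by auto
      moreover have "l < d" if "l = a \<or> l div s = i \<or> l = j"
        using that 2 s block_less[of l 0] block_less[of l i] block_less[of l "i + 1"]
        by (auto simp: in_block_iff)
      ultimately show ?thesis
        unfolding eq using of_nat_in_Nats by (auto simp del: of_nat_add of_nat_mult)
    qed
    then show "Poly_Mapping.lookup v l \<in> \<nat>" "Poly_Mapping.lookup v l \<le> real k"
      "d \<le> l \<Longrightarrow> Poly_Mapping.lookup v l = 0" by auto
  qed
  have VQ: "lattice_dk_polytope d k Q"
    unfolding Q_def
  proof (rule lattice_dk_polytope_convex_hull)
    show "finite VQ" "VQ \<noteq> {}"
      by (auto simp: VQ_def)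
  next
    fix v l assume v: "v \<in> VQ"
    then consider "v = 0"
      | i j where "i < n" "even i" "j \<in> block s (i + 1)" "v = w i j"
      by (auto simp: VQ_def)
    then have "Poly_Mapping.lookup v l \<in> \<nat> \<and> Poly_Mapping.lookup v l \<le> real k \<and>
        (d \<le> l \<longrightarrow> Poly_Mapping.lookup v l = 0)"
    proof cases
      case 2
      have eq: "Poly_Mapping.lookup v l = real (k * of_bool (l div s = i) + of_bool (l = j))"
        using 2 lookup_w by simp
      have "j div s = i + 1"
        using 2 s in_block_iff by blast
      then have "k * of_bool (l div s = i) + of_bool (l = j) \<le> k"
        using k by auto
      moreover have "l < d" if "l div s = i \<or> l = j"
        using that 2 s block_less[of l i] block_less[of l "i + 1"]
        by (auto simp: in_block_iff)
      ultimately show ?thesis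
        unfolding eq using of_nat_in_Nats by (auto simp del: of_nat_add of_nat_mult)
    qed simp
    then show "Poly_Mapping.lookup v l \<in> \<nat>" "Poly_Mapping.lookup v l \<le> real k"
      "d \<le> l \<Longrightarrow> Poly_Mapping.lookup v l = 0" by auto
  qed

  \<comment> \<open>Disjointness by a separating linear form\<close>
  define f where "f = weighted_sum d (\<lambda>j. (- m) ^ (j div s))"
  have linf: "linear f"
    by (simp add: f_def linear_weighted_sum)
  have f_unit: "f (unit_vec j) = (- m) ^ i" if "j \<in> block s i" "i \<le> n" for i j
    using that block_less[OF that] s by (simp add: f_def weighted_sum_unit_vec in_block_iff)
  have f_ind: "f (ind_vec (block s i)) = real s * (- m) ^ i" if "i \<le> n" for i
    using that f_unit by (simp add: ind_vec_def linear_sum[OF linf])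
  \<comment> \<open>Since \<open>m = k * s\<close>, the block contributes \<open>m * (-m)^i\<close>,
    which cancels the \<open>(-m)^(i+1)\<close> from \<open>unit_vec j\<close>.\<close>
  have f_w: "f (w i j) = 0" if "j \<in> block s (i + 1)" "i < n" for i j
    using that f_unit[of j "i + 1"] f_ind[of i]
    by (simp add: w_def linear_add[OF linf] linear_cmul[OF linf] m_def)
  have "f v = 1" if "v \<in> VP" for v
    using that f_w f_unit[of _ 0] by (auto simp: VP_def linear_add[OF linf])
  moreover have "f v = 0" if "v \<in> VQ" for v
    using that f_w by (auto simp: VQ_def linear_0[OF linf])
  ultimately have "f x = 1" if "x \<in> P" for x
    using that linear_const_on_convex_hull[OF linf] unfolding P_def by blast
  moreover have "f x = 0" if "x \<in> Q" for x
    using that linear_const_on_convex_hull[OF linf \<open>\<And>v. v \<in> VQ \<Longrightarrow> f v = 0\<close>] unfolding Q_def by blast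
  ultimately have disj: "P \<inter> Q = {}"
    by force

  \<comment> \<open>Two close points\<close>
  define z where "z = (1 / real s) *\<^sub>R ind_vec (block s 0)"
  define t where "t i = real k *\<^sub>R ind_vec (block s i) + (1 / real s) *\<^sub>R ind_vec (block s (i + 1))" for i
  have ne: "block s i \<noteq> {}" for i
    using s card_block[of s i] by force
  have avg: "v + (1 / real s) *\<^sub>R ind_vec (block s i) \<in> S"
    if "convex S" "\<And>j. j \<in> block s i \<Longrightarrow> v + unit_vec j \<in> S" for S v i
    using convex_average[of S "block s i" v unit_vec] that ne by (simp add: ind_vec_def)
  have convP: "convex P" and convQ: "convex Q"
    by (simp_all add: P_def Q_def convex_convex_hull)
  have inP: "v \<in> P" if "v \<in> VP" for v
    using that unfolding P_def by (rule hull_inc)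
  have inQ: "v \<in> Q" if "v \<in> VQ" for v
    using that unfolding Q_def by (rule hull_inc)
  have zP: "z \<in> P"
    using avg[of P 0 0, OF convP] inP by (auto simp: z_def VP_def)
  have tP: "z + t i \<in> P" if "i < n" "odd i" for i
  proof -
    have "(z + real k *\<^sub>R ind_vec (block s i)) + unit_vec j \<in> P" if j: "j \<in> block s (i + 1)" for j
    proof -
      \<comment> \<open>Two averagings: first over \<open>a\<close> with \<open>j\<close> fixed,
        which gives \<open>z\<close>, then over \<open>j\<close>.\<close>
      have "w i j + unit_vec a \<in> P" if "a \<in> block s 0" for a
        using that j \<open>i < n\<close> \<open>odd i\<close> by (intro inP) (force simp: VP_def add.commute)
      then have "w i j + z \<in> P"
        unfolding z_def by (intro avg convP)
      then show ?thesis
        by (simp add: w_def add_ac)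
    qed
    from avg[OF convP this] show ?thesis
      by (simp add: t_def add_ac)
  qed
  have tQ: "0 + t i \<in> Q" if "i < n" "even i" for i
  proof -
    have "real k *\<^sub>R ind_vec (block s i) + unit_vec j \<in> Q" if "j \<in> block s (i + 1)" for j
      using that \<open>i < n\<close> \<open>even i\<close> by (intro inQ) (force simp: VQ_def w_def)
    from avg[OF convQ this] show ?thesis
      by (simp add: t_def)
  qed
  \<comment> \<open>These weights satisfy \<open>c 0 * k = 1 / s\<close>, matching \<open>z\<close>,
    and \<open>c (i + 1) * k = c i / s\<close>, so that neighbouring terms cancel in the
    difference.\<close>
  define c where "c i = 1 / m ^ (i + 1)" for i
  have c_nonneg: "c i \<ge> 0" for i
    using m2 by (simp add: c_def)
  have c_sum: "sum c I \<le> 1" if "I \<subseteq> {..<n}" for I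
  proof -
    have "sum c I \<le> sum c {..<n}"
      using that by (intro sum_mono2) (auto intro: c_nonneg)
    also have "\<dots> \<le> 1"
      unfolding c_def by (rule sum_inverse_powers_le_1[OF m2])
    finally show ?thesis .
  qed
  define p where "p = z + (\<Sum>i\<in>{i. i < n \<and> odd i}. c i *\<^sub>R t i)"
  \<comment> \<open>The origin, a generator of \<open>Q\<close>, plays the part that
    \<open>z\<close> has in \<open>p\<close>.\<close>
  define q where "q = 0 + (\<Sum>i\<in>{i. i < n \<and> even i}. c i *\<^sub>R t i)"
  have pP: "p \<in> P"
    unfolding p_def using convP zP tP c_sum
    by (intro convex_add_subunit_sum) (auto intro: c_nonneg c_sum)
  have qQ: "q \<in> Q"
    unfolding q_def using convQ tQ c_sum inQ[of 0]
    by (intro convex_add_subunit_sum) (auto simp: VQ_def intro: c_nonneg c_sum)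

  \<comment> \<open>Telescoping of the difference\<close>
  define g where "g i = ((- 1) ^ i / m ^ i / real s) *\<^sub>R ind_vec (block s i)" for i
  have g_diff: "((- 1) ^ i * c i) *\<^sub>R t i = g i - g (Suc i)" for i
  proof -
    have "(- 1) ^ i * c i * real k = (- 1) ^ i / m ^ i / real s"
      using m2 s k by (simp add: c_def m_def field_simps power_divide)
    moreover have "(- 1) ^ i * c i / real s = - ((- 1) ^ Suc i / m ^ Suc i / real s)"
      using m2 s by (simp add: c_def field_simps power_divide)
    ultimately show ?thesis
      by (simp add: t_def g_def scaleR_right_distrib del: power_Suc)
  qed
  \<comment> \<open>Even indices come from \<open>q\<close> and odd ones from \<open>p\<close>,
    hence the sign \<open>(- 1) ^ i\<close>; the remaining \<open>z\<close> is
    \<open>g 0\<close>.\<close>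
  have "q - p = (\<Sum>i<n. ((- 1) ^ i * c i) *\<^sub>R t i) - z"
  proof -
    have "(\<Sum>i<n. ((- 1) ^ i * c i) *\<^sub>R t i) =
        (\<Sum>i\<in>{i. i < n \<and> even i} \<union> {i. i < n \<and> odd i}. ((- 1) ^ i * c i) *\<^sub>R t i)"
      by (intro sum.cong) auto
    also have "\<dots> = (\<Sum>i\<in>{i. i < n \<and> even i}. ((- 1) ^ i * c i) *\<^sub>R t i) +
        (\<Sum>i\<in>{i. i < n \<and> odd i}. ((- 1) ^ i * c i) *\<^sub>R t i)"
      by (intro sum.union_disjoint) auto
    also have "\<dots> = (\<Sum>i\<in>{i. i < n \<and> even i}. c i *\<^sub>R t i) - (\<Sum>i\<in>{i. i < n \<and> odd i}. c i *\<^sub>R t i)"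
      by (simp add: sum_negf[symmetric])
    finally show ?thesis
      by (simp add: p_def q_def)
  qed
  also have "\<dots> = (g 0 - g n) - z"
    unfolding g_diff by (simp add: sum_lessThan_telescope')
  also have "\<dots> = - g n"
    by (simp add: g_def z_def)
  finally have "p - q = g n"
    by (metis minus_diff_eq minus_minus)
  then have pq: "Poly_Mapping.lookup p j - Poly_Mapping.lookup q j = (- 1) ^ n / m ^ n / real s *
      of_bool (j \<in> block s n)" for j
    by (metis lookup_minus g_def lookup_scaleR real_scaleR_def lookup_ind_vec finite_block)
  \<comment> \<open>Bounding by the sum of absolute values suffices: the \<open>s\<close> nonzero
    entries of size \<open>1 / (m ^ n * s)\<close> add up to \<open>1 / m ^ n\<close>.\<close>
  have "edist d p q \<le> (\<Sum>j<d. \<bar>(- 1) ^ n / m ^ n / real s * of_bool (j \<in> block s n)\<bar>)"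
    unfolding edist_def pq by (rule L2_set_le_sum_abs)
  also have "\<dots> = (\<Sum>j\<in>block s n. (1 / m ^ n) / real s)"
    using m2 block_less
    by (intro sum.mono_neutral_cong_right) (auto simp: power_abs abs_mult power_divide)
  also have "\<dots> = 1 / m ^ n"
    using s by simp
  finally have "esetdist d P Q \<le> 1 / m ^ n"
    using esetdist_le_edist[OF pP qQ, of d] by simp
  with VP VQ disj show ?thesis
    unfolding m_def by blast
qed

section \<open>Choice of \<open>n\<close> and \<open>s\<close> for large \<open>d\<close>\<close>

theorem theorem3p2:
  fixes k :: nat and \<alpha> :: real
  assumes "k > 0" and "0 < \<alpha>" and "\<alpha> < 1"
  shows "\<exists>d\<^sub>0::nat. \<forall>d\<ge>d\<^sub>0. \<exists>P Q.
           lattice_dk_polytope d k P \<and> lattice_dk_polytope d k Q \<and> P \<inter> Q = {} \<and>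
           esetdist d P Q
             \<le> 1 / (real k powr (real d powr \<alpha>) * real d powr ((1 - \<alpha>) * real d powr \<alpha>))"
proof -
  \<comment> \<open>The bound \<open>2\<close> yields \<open>n + 1 \<le> 3 * N\<close> below; the
    bound \<open>16\<close> yields both \<open>Y / 3 - 1 \<ge> Y / 4\<close> and
    \<open>X \<le> (X / 4)^2\<close>.\<close>
  have "eventually (\<lambda>d::nat. real d powr \<alpha> \<ge> 2) sequentially"
    using assms by real_asymp
  moreover have "eventually (\<lambda>d::nat. real d powr (1 - \<alpha>) \<ge> 16) sequentially"
    using assms by real_asymp
  ultimately have "eventually (\<lambda>d::nat. real d powr \<alpha> \<ge> 2 \<and> real d powr (1 - \<alpha>) \<ge> 16 \<and> d > 0) sequentially"
    using eventually_gt_at_top[of 0] by eventually_elim auto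
  then obtain d\<^sub>0 :: nat where d0: "\<And>d. d \<ge> d\<^sub>0 \<Longrightarrow>
      real d powr \<alpha> \<ge> 2 \<and> real d powr (1 - \<alpha>) \<ge> 16 \<and> d > 0"
    by (auto simp: eventually_sequentially)
  have "\<exists>P Q. lattice_dk_polytope d k P \<and> lattice_dk_polytope d k Q \<and> P \<inter> Q = {} \<and>
           esetdist d P Q
             \<le> 1 / (real k powr (real d powr \<alpha>) * real d powr ((1 - \<alpha>) * real d powr \<alpha>))"
    if "d \<ge> d\<^sub>0" for d
  proof -
    define N where "N = real d powr \<alpha>"
    define Y where "Y = real d powr (1 - \<alpha>)"
    define X where "X = real k * Y"
    define n where "n = nat \<lceil>2 * N\<rceil>"
    define s where "s = d div (n + 1)"
    have N: "N \<ge> 2" and Y: "Y \<ge> 16" and d: "d > 0"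
      using d0[OF that] by (auto simp: N_def Y_def)
    have NY: "N * Y = real d"
      using d by (simp add: N_def Y_def flip: powr_add)
    have X: "X \<ge> 16"
      using Y assms(1) mult_mono[of 1 "real k" 16 Y] by (simp add: X_def)
    have n: "2 * N \<le> real n" "real n + 1 \<le> 3 * N"
      using N unfolding n_def by linarith+
    have "Y / 3 = real d / (3 * N)"
      using N by (simp flip: NY)
    also have "\<dots> \<le> real d / (real n + 1)"
      using n N by (intro divide_left_mono) auto
    \<comment> \<open>Rounding down in \<open>s\<close> loses less than \<open>1\<close>.\<close>
    also have "\<dots> \<le> real s + 1"
    proof -
      have "d < (s + 1) * (n + 1)"
        unfolding s_def using dividend_less_div_times[of "n + 1" d] by simp
      then have "real d < real ((s + 1) * (n + 1))"
        by linarith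
      then show ?thesis
        by (simp add: field_simps)
    qed
    finally have sY: "Y / 4 \<le> real s"
      using Y by simp
    then have ks: "X / 4 \<le> real (k * s)"
      by (simp add: X_def mult_left_mono flip: times_divide_eq_right)
    have "s > 0"
      using sY Y by (auto intro!: Nat.gr0I)
    have "k * s \<ge> 2"
      using ks X by linarith
    moreover have "(n + 1) * s \<le> d"
      by (simp only: s_def times_div_less_eq_dividend)
    ultimately obtain P Q where PQ: "lattice_dk_polytope d k P" "lattice_dk_polytope d k Q" "P \<inter> Q = {}"
        "esetdist d P Q \<le> 1 / real (k * s) ^ n"
      using close_lattice_polytopes[of k s n d] assms(1) by blast
    have "real k powr N * real d powr ((1 - \<alpha>) * N) = X powr N"
      by (simp add: X_def Y_def powr_mult powr_powr)
    \<comment> \<open>The factor \<open>4\<close> lost in the base is repaid by squaring, as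
      \<open>X \<ge> 16\<close>; the exponent \<open>2 * N\<close> is then at most
      \<open>n\<close>.\<close>
    also have "\<dots> \<le> ((X / 4) powr 2) powr N"
      using X N by (intro powr_mono2) (auto simp: power2_eq_square)
    also have "\<dots> \<le> (X / 4) powr real n"
      using X n by (subst powr_powr) (auto intro!: powr_mono)
    also have "\<dots> \<le> real (k * s) ^ n"
      using X ks by (subst powr_realpow) (auto intro!: power_mono)
    finally have "1 / real (k * s) ^ n \<le> 1 / (real k powr N * real d powr ((1 - \<alpha>) * N))"
      using assms(1) d \<open>s > 0\<close> by (intro divide_left_mono mult_pos_pos zero_less_power) auto
    with PQ show ?thesis
      unfolding N_def by fastforce
  qed
  then show ?thesis by blast
qed

end
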